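(* Let $G$ be an l.c.s.c. group with left Haar measure $m_G$, $A$ a Polish $G$-module, $p\geq 1$, and $f:G^{p+1}\to A$ almost type-I. Then for $m_G$-almost every $h\in G$ the slice $f_h:G^p\to A$, $f_h(g_1,\dots,g_p):=f(g_1,\dots,g_p,h)$, is almost type-I. If $G$ is an algebraic subgroup of $\mathrm{GL}_n(\mathbb{R})$ and $f$ is almost type-II, then $f_h$ is almost type-II for a.e. $h$. If moreover $f$ is $G$-equivariant, i.e. $f(kg_1,\dots,kg_{p+1})=k\cdot f(g_1,\dots,g_{p+1})$ for all $k,g_i\in G$, then these conclusions hold for every $h\in G$; and if $f$ is also regular at the identity then $f_h$ is regular at $(h,\dots,h)\in G^p$.
   Context: For $X=G^q$ with Haar measure and $A$ a Polish Abelian group: $f:X\to A$ is of type I if it is locally finite-valued and locally constant on some open set of full measure; almost type-I if a locally uniform limit (uniform on compacts) of type-I functions. For algebraic $G\le\mathrm{GL}_n(\mathbb{R})$, type II means locally finite-valued with level sets agreeing locally with semi-algebraic subsets of $G^q$; almost type-II means a locally uniform limit of type-II functions. An almost type-I (resp. II) function is regular at $x_0$ if it is a locally uniform limit of type-I (resp. II) functions each locally constant on a neighbourhood of $x_0$. *)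

theory Defs
  imports "HOL-Analysis.Analysis" "HOL-Probability.Probability"
begin

section \<open>Locally compact second countable groups (carrier-based)\<close>

definition lcsc_group :: "'g::topological_space set \<Rightarrow> ('g \<Rightarrow> 'g \<Rightarrow> 'g) \<Rightarrow> ('g \<Rightarrow> 'g) \<Rightarrow> 'g \<Rightarrow> bool" where
  "lcsc_group G mul iv e \<longleftrightarrow>
     e \<in> G \<and> (\<forall>x\<in>G. \<forall>y\<in>G. mul x y \<in> G) \<and> (\<forall>x\<in>G. iv x \<in> G) \<and>
     (\<forall>x\<in>G. \<forall>y\<in>G. \<forall>z\<in>G. mul (mul x y) z = mul x (mul y z)) \<and>
     (\<forall>x\<in>G. mul e x = x \<and> mul x e = x) \<and>
     (\<forall>x\<in>G. mul (iv x) x = e \<and> mul x (iv x) = e) \<and>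
     continuous_on (G \<times> G) (\<lambda>(x, y). mul x y) \<and> continuous_on G iv \<and>
     Hausdorff_space (top_of_set G) \<and> locally_compact_space (top_of_set G) \<and>
     second_countable (top_of_set G)"

text \<open>A left Haar measure on the Borel sets of G: left invariant, finite on compact sets,
  positive on nonempty open sets.\<close>
definition left_haar :: "'g::topological_space set \<Rightarrow> ('g \<Rightarrow> 'g \<Rightarrow> 'g) \<Rightarrow> 'g measure \<Rightarrow> bool" where
  "left_haar G mul M \<longleftrightarrow>
     space M = G \<and> sets M = sets (restrict_space borel G) \<and>
     (\<forall>g\<in>G. \<forall>S\<in>sets M. emeasure M ((mul g) ` S) = emeasure M S) \<and>
     (\<forall>K. compact K \<and> K \<subseteq> G \<longrightarrow> emeasure M K < \<infinity>) \<and>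
     (\<forall>U. openin (top_of_set G) U \<and> U \<noteq> {} \<longrightarrow> emeasure M U > 0)"

text \<open>Polish G-module: A is a Polish abelian topological group (type class), with a
  continuous action of G by group automorphisms.\<close>
definition polish_G_module :: "'g::topological_space set \<Rightarrow> ('g \<Rightarrow> 'g \<Rightarrow> 'g) \<Rightarrow> 'g \<Rightarrow>
     ('g \<Rightarrow> 'a::{polish_space, topological_ab_group_add} \<Rightarrow> 'a) \<Rightarrow> bool" where
  "polish_G_module G mul e act \<longleftrightarrow>
     (\<forall>a. act e a = a) \<and>
     (\<forall>g\<in>G. \<forall>h\<in>G. \<forall>a. act (mul g h) a = act g (act h a)) \<and>
     (\<forall>g\<in>G. \<forall>a b. act g (a + b) = act g a + act g b) \<and>
     continuous_on (G \<times> UNIV) (\<lambda>(g, a). act g a)"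

section \<open>Powers G^q\<close>

text \<open>G^p is represented inside the type 'g^'n (p = CARD('n)); G^(p+1) as G^p \<times> G.\<close>
definition gpow :: "'g set \<Rightarrow> ('g ^ 'n::finite) set" where
  "gpow G = {x. \<forall>i. x $ i \<in> G}"

definition vec_measure :: "'g measure \<Rightarrow> ('g ^ 'n::finite) measure" where
  "vec_measure M = embed_measure (PiM UNIV (\<lambda>_::'n. M)) vec_lambda"

section \<open>Type I / type II functions\<close>

definition locally_finite_valued :: "'x::topological_space set \<Rightarrow> ('x \<Rightarrow> 'a) \<Rightarrow> bool" where
  "locally_finite_valued X f \<longleftrightarrow>
     (\<forall>x\<in>X. \<exists>U. openin (top_of_set X) U \<and> x \<in> U \<and> finite (f ` U))"

definition locally_constant_on :: "'x::topological_space set \<Rightarrow> 'x set \<Rightarrow> ('x \<Rightarrow> 'a) \<Rightarrow> bool" where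
  "locally_constant_on X U f \<longleftrightarrow>
     (\<forall>x\<in>U. \<exists>V. openin (top_of_set X) V \<and> x \<in> V \<and> V \<subseteq> U \<and> (\<forall>y\<in>V. f y = f x))"

definition typeI :: "'x::topological_space set \<Rightarrow> 'x measure \<Rightarrow> ('x \<Rightarrow> 'a) \<Rightarrow> bool" where
  "typeI X \<mu> f \<longleftrightarrow> locally_finite_valued X f \<and>
     (\<exists>U. openin (top_of_set X) U \<and> X - U \<in> null_sets \<mu> \<and> locally_constant_on X U f)"

text \<open>Uniform convergence on K with respect to the (canonical) group uniformity of A.\<close>
definition unif_conv_on :: "'x set \<Rightarrow> (nat \<Rightarrow> 'x \<Rightarrow> 'a::topological_ab_group_add) \<Rightarrow> ('x \<Rightarrow> 'a) \<Rightarrow> bool" where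
  "unif_conv_on K F f \<longleftrightarrow>
     (\<forall>V. open V \<and> 0 \<in> V \<longrightarrow> (\<forall>\<^sub>F n in sequentially. \<forall>x\<in>K. F n x - f x \<in> V))"

definition locally_uniform_limit :: "'x::topological_space set \<Rightarrow> (nat \<Rightarrow> 'x \<Rightarrow> 'a::topological_ab_group_add) \<Rightarrow> ('x \<Rightarrow> 'a) \<Rightarrow> bool" where
  "locally_uniform_limit X F f \<longleftrightarrow> (\<forall>K. compact K \<and> K \<subseteq> X \<longrightarrow> unif_conv_on K F f)"

definition almost_typeI :: "'x::topological_space set \<Rightarrow> 'x measure \<Rightarrow> ('x \<Rightarrow> 'a::topological_ab_group_add) \<Rightarrow> bool" where
  "almost_typeI X \<mu> f \<longleftrightarrow> (\<exists>F. (\<forall>n. typeI X \<mu> (F n)) \<and> locally_uniform_limit X F f)"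

definition regular_typeI :: "'x::topological_space set \<Rightarrow> 'x measure \<Rightarrow> ('x \<Rightarrow> 'a::topological_ab_group_add) \<Rightarrow> 'x \<Rightarrow> bool" where
  "regular_typeI X \<mu> f x0 \<longleftrightarrow> almost_typeI X \<mu> f \<and>
     (\<exists>F. (\<forall>n. typeI X \<mu> (F n) \<and>
              (\<exists>V. openin (top_of_set X) V \<and> x0 \<in> V \<and> (\<forall>y\<in>V. F n y = F n x0)))
          \<and> locally_uniform_limit X F f)"

text \<open>Semi-algebraic sets: finite Boolean combinations of sets {p = 0} and {p > 0},
  p a real polynomial function (in the real coordinates).\<close>
inductive_set semialgebraic :: "('x::real_normed_vector) set set" where
  zero: "real_polynomial_function p \<Longrightarrow> {x. p x = 0} \<in> semialgebraic"
| pos: "real_polynomial_function p \<Longrightarrow> {x. p x > 0} \<in> semialgebraic"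
| compl: "S \<in> semialgebraic \<Longrightarrow> - S \<in> semialgebraic"
| union: "S \<in> semialgebraic \<Longrightarrow> T \<in> semialgebraic \<Longrightarrow> S \<union> T \<in> semialgebraic"

definition typeII :: "'x::real_normed_vector set \<Rightarrow> ('x \<Rightarrow> 'a) \<Rightarrow> bool" where
  "typeII X f \<longleftrightarrow> locally_finite_valued X f \<and>
     (\<forall>x\<in>X. \<exists>U. openin (top_of_set X) U \<and> x \<in> U \<and>
        (\<forall>a. \<exists>S\<in>semialgebraic. {y\<in>U. f y = a} = S \<inter> U))"

definition almost_typeII :: "'x::real_normed_vector set \<Rightarrow> ('x \<Rightarrow> 'a::topological_ab_group_add) \<Rightarrow> bool" where
  "almost_typeII X f \<longleftrightarrow> (\<exists>F. (\<forall>n. typeII X (F n)) \<and> locally_uniform_limit X F f)"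

definition regular_typeII :: "'x::real_normed_vector set \<Rightarrow> ('x \<Rightarrow> 'a::topological_ab_group_add) \<Rightarrow> 'x \<Rightarrow> bool" where
  "regular_typeII X f x0 \<longleftrightarrow> almost_typeII X f \<and>
     (\<exists>F. (\<forall>n. typeII X (F n) \<and>
              (\<exists>V. openin (top_of_set X) V \<and> x0 \<in> V \<and> (\<forall>y\<in>V. F n y = F n x0)))
          \<and> locally_uniform_limit X F f)"

section \<open>Algebraic subgroups of GL_n(R)\<close>

definition algebraic_subgroup :: "(real ^ 'k ^ 'k) set \<Rightarrow> bool" where
  "algebraic_subgroup G \<longleftrightarrow>
     (\<exists>P. (\<forall>p\<in>P. real_polynomial_function p) \<and>
          G = {A. invertible A \<and> (\<forall>p\<in>P. p A = 0)}) \<and>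
     mat 1 \<in> G \<and> (\<forall>A\<in>G. \<forall>B\<in>G. A ** B \<in> G) \<and> (\<forall>A\<in>G. matrix_inv A \<in> G)"

definition equivariant :: "'g set \<Rightarrow> ('g \<Rightarrow> 'g \<Rightarrow> 'g) \<Rightarrow> ('g \<Rightarrow> 'a \<Rightarrow> 'a) \<Rightarrow>
     (('g ^ 'n::finite) \<times> 'g \<Rightarrow> 'a) \<Rightarrow> bool" where
  "equivariant G mul act f \<longleftrightarrow>
     (\<forall>k\<in>G. \<forall>x\<in>gpow G. \<forall>h\<in>G. f (\<chi> i. mul k (x $ i), mul k h) = act k (f (x, h)))"

end

theory Submission
  imports Defs
begin

(* Slices of almost type-I / type-II functions on G^(p+1) = G^p \<times> G.

   The slice x \<mapsto> f (x, h) is f precomposed with the continuous map x \<mapsto> (x, h).  So the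
   file starts with general facts on precomposition with a continuous map P (and
   postcomposition with a continuous additive map \<phi>): local finiteness, local constancy and
   locally uniform limits are preserved; type I is preserved when P pulls the exceptional
   null set back to a null set; type II is preserved when P is polynomial.
   For a Haar measure, Fubini shows that the exceptional null sets of countably many type-I
   functions have null slices for almost every h, giving the a.e. statement; type-II slices
   need no measure theory and hold for every h.
   If f is equivariant, the slice at h is obtained from the slice at any c by translating
   by k = h c\<inverse> and applying k to the values ("shift_slice").  Translations preserve
   Haar-null sets, so one good c gives every h.  For regularity the slices of the
   approximants F_n are taken at good points c_n close to e (inside the neighbourhood on
   which F_n is constant), and the shifted slices still converge locally uniformly because
   the c_n stay in a compact set and G acts uniformly continuously on compacta.
   Order of the file: precomposition lemmas; semi-algebraic sets and type II; diagonal
   translation in an lcsc group; Haar measure (translation invariance, Fubini, good slicing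
   points); G-modules and shifted slices; slices of almost type-I and type-II functions;
   the theorem. *)

section \<open>Precomposition with continuous maps\<close>

text \<open>Throughout, \<open>P\<close> maps \<open>A\<close> continuously into \<open>X\<close> and \<open>\<phi>\<close> acts on the values.
  Local finiteness and local constancy pull back along \<open>P\<close>: use preimages of neighbourhoods.\<close>

lemma locally_finite_valued_comp:
  assumes "locally_finite_valued X g" "continuous_on A P" "P \<in> A \<rightarrow> X"
  shows "locally_finite_valued A (\<lambda>x. \<phi> (g (P x)))"
  unfolding locally_finite_valued_def
proof
  fix x assume x: "x \<in> A"
  then obtain U where U: "openin (top_of_set X) U" "P x \<in> U" "finite (g ` U)"
    using assms(1,3) unfolding locally_finite_valued_def by blast
  have "(\<lambda>x. \<phi> (g (P x))) ` (A \<inter> P -` U) \<subseteq> \<phi> ` g ` U" by blast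
  then have "finite ((\<lambda>x. \<phi> (g (P x))) ` (A \<inter> P -` U))"
    using U(3) finite_subset by blast
  moreover have "openin (top_of_set A) (A \<inter> P -` U)"
    by (rule continuous_openin_preimage[OF assms(2,3) U(1)])
  ultimately show "\<exists>U. openin (top_of_set A) U \<and> x \<in> U \<and> finite ((\<lambda>x. \<phi> (g (P x))) ` U)"
    using U(2) x by blast
qed

lemma locally_constant_on_comp:
  assumes "locally_constant_on X U g" "continuous_on A P" "P \<in> A \<rightarrow> X"
  shows "locally_constant_on A (A \<inter> P -` U) (\<lambda>x. \<phi> (g (P x)))"
  unfolding locally_constant_on_def
proof
  fix x assume x: "x \<in> A \<inter> P -` U"
  then obtain V where V: "openin (top_of_set X) V" "P x \<in> V" "V \<subseteq> U" "\<forall>y\<in>V. g y = g (P x)"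
    using assms(1) unfolding locally_constant_on_def by blast
  show "\<exists>W. openin (top_of_set A) W \<and> x \<in> W \<and> W \<subseteq> A \<inter> P -` U \<and>
            (\<forall>y\<in>W. \<phi> (g (P y)) = \<phi> (g (P x)))"
  proof (intro exI[of _ "A \<inter> P -` V"] conjI)
    show "openin (top_of_set A) (A \<inter> P -` V)" by (rule continuous_openin_preimage[OF assms(2,3) V(1)])
    show "x \<in> A \<inter> P -` V" "A \<inter> P -` V \<subseteq> A \<inter> P -` U" using x V(2,3) by auto
    show "\<forall>y\<in>A \<inter> P -` V. \<phi> (g (P y)) = \<phi> (g (P x))"
      using V(4) by (metis IntD2 vimageE)
  qed
qed

text \<open>Type I survives precomposition as soon as the exceptional set pulls back to a null set.\<close>

lemma typeI_comp:
  assumes "locally_finite_valued X g" "openin (top_of_set X) U" "locally_constant_on X U g"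
    and P: "continuous_on A P" "P \<in> A \<rightarrow> X"
    and null: "A \<inter> P -` (X - U) \<in> null_sets \<nu>"
  shows "typeI A \<nu> (\<lambda>x. \<phi> (g (P x)))"
  unfolding typeI_def
proof (intro conjI exI)
  show "locally_finite_valued A (\<lambda>x. \<phi> (g (P x)))" by (rule locally_finite_valued_comp[OF assms(1) P])
  show "openin (top_of_set A) (A \<inter> P -` U)" by (rule continuous_openin_preimage[OF P assms(2)])
  show "locally_constant_on A (A \<inter> P -` U) (\<lambda>x. \<phi> (g (P x)))"
    by (rule locally_constant_on_comp[OF assms(3) P])
  have "A - (A \<inter> P -` U) = A \<inter> P -` (X - U)" using P(2) by blast
  then show "A - (A \<inter> P -` U) \<in> null_sets \<nu>" using null by simp
qed

text \<open>In particular when \<open>P\<close> pulls back every null set to a null set.\<close>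

lemma typeI_comp_null_preserving:
  assumes "typeI X \<mu> g" "continuous_on A P" "P \<in> A \<rightarrow> X"
    and "\<And>N. N \<in> null_sets \<mu> \<Longrightarrow> A \<inter> P -` N \<in> null_sets \<nu>"
  shows "typeI A \<nu> (\<lambda>x. \<phi> (g (P x)))"
proof -
  obtain U where "openin (top_of_set X) U" "X - U \<in> null_sets \<mu>" "locally_constant_on X U g"
    using assms(1) unfolding typeI_def by blast
  moreover have "locally_finite_valued X g" using assms(1) unfolding typeI_def by blast
  ultimately show ?thesis using typeI_comp[OF _ _ _ assms(2,3)] assms(4)[of "X - U"] by blast
qed

text \<open>Locally uniform convergence survives precomposition (images of compacta are compact)
  and postcomposition with a continuous additive map.  (\<open>Modules.additive\<close> is the group
  homomorphism predicate; the unqualified name denotes additivity of set functions.)\<close>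

lemma locally_uniform_limit_comp:
  fixes F :: "nat \<Rightarrow> 'x::topological_space \<Rightarrow> 'c::topological_ab_group_add"
    and \<phi> :: "'c \<Rightarrow> 'd::topological_ab_group_add" and P :: "'w::topological_space \<Rightarrow> 'x"
  assumes "locally_uniform_limit X F g" "continuous_on A P" "P \<in> A \<rightarrow> X"
    and "continuous_on UNIV \<phi>" "Modules.additive \<phi>"
  shows "locally_uniform_limit A (\<lambda>n x. \<phi> (F n (P x))) (\<lambda>x. \<phi> (g (P x)))"
  unfolding locally_uniform_limit_def unif_conv_on_def
proof (intro allI impI)
  fix K and V :: "'d set" assume K: "compact K \<and> K \<subseteq> A" and V: "open V \<and> 0 \<in> V"
  have "compact (P ` K)"
    using K by (intro compact_continuous_image continuous_on_subset[OF assms(2)]) auto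
  moreover have "P ` K \<subseteq> X" using K assms(3) by blast
  moreover have "open (\<phi> -` V)" using V assms(4) by (intro open_vimage) auto
  moreover have "0 \<in> \<phi> -` V" using V additive.zero[OF assms(5)] by simp
  ultimately have "\<forall>\<^sub>F n in sequentially. \<forall>y\<in>P ` K. F n y - g y \<in> \<phi> -` V"
    using assms(1) unfolding locally_uniform_limit_def unif_conv_on_def by blast
  then show "\<forall>\<^sub>F n in sequentially. \<forall>x\<in>K. \<phi> (F n (P x)) - \<phi> (g (P x)) \<in> V"
    by (rule eventually_mono) (auto simp: additive.diff[OF assms(5), symmetric])
qed

text \<open>Only the values on the domain matter.\<close>

lemma locally_uniform_limit_cong:
  fixes F :: "nat \<Rightarrow> 'x::topological_space \<Rightarrow> 'b::topological_ab_group_add"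
  assumes "locally_uniform_limit A F f" "\<And>x. x \<in> A \<Longrightarrow> f x = g x"
  shows "locally_uniform_limit A F g"
  unfolding locally_uniform_limit_def unif_conv_on_def
proof (intro allI impI)
  fix K and V :: "'b set" assume K: "compact K \<and> K \<subseteq> A" and V: "open V \<and> 0 \<in> V"
  then have "\<forall>\<^sub>F n in sequentially. \<forall>x\<in>K. F n x - f x \<in> V"
    using assms(1) unfolding locally_uniform_limit_def unif_conv_on_def by blast
  then show "\<forall>\<^sub>F n in sequentially. \<forall>x\<in>K. F n x - g x \<in> V"
    by (rule eventually_mono) (use K assms(2) in \<open>metis subsetD\<close>)
qed

lemma almost_typeI_cong:
  assumes "almost_typeI A \<nu> f" "\<And>x. x \<in> A \<Longrightarrow> f x = g x"
  shows "almost_typeI A \<nu> g"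
proof -
  obtain F where F: "\<forall>n. typeI A \<nu> (F n)" "locally_uniform_limit A F f"
    using assms(1) unfolding almost_typeI_def by blast
  show ?thesis
    unfolding almost_typeI_def using F(1) locally_uniform_limit_cong[OF F(2) assms(2)] by blast
qed

text \<open>Unpacking regularity: approximants together with neighbourhoods of the base point on
  which they are constant.\<close>

lemma regular_approximants:
  assumes "\<exists>F. (\<forall>n. T (F n) \<and> (\<exists>V. openin (top_of_set X) V \<and> x0 \<in> V \<and> (\<forall>y\<in>V. F n y = F n x0)))
             \<and> locally_uniform_limit X F f"
  obtains F V where "\<And>n. T (F n)" "locally_uniform_limit X F f"
    "\<And>n. openin (top_of_set X) (V n)" "\<And>n. x0 \<in> V n" "\<And>n. \<forall>y\<in>V n. F n y = F n x0"
proof -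
  obtain F where F: "\<forall>n. T (F n) \<and> (\<exists>V. openin (top_of_set X) V \<and> x0 \<in> V \<and> (\<forall>y\<in>V. F n y = F n x0))"
      "locally_uniform_limit X F f"
    using assms by blast
  then have "\<forall>n. \<exists>V. openin (top_of_set X) V \<and> x0 \<in> V \<and> (\<forall>y\<in>V. F n y = F n x0)" by blast
  then have "\<exists>V. \<forall>n. openin (top_of_set X) (V n) \<and> x0 \<in> V n \<and> (\<forall>y\<in>V n. F n y = F n x0)"
    by (rule choice)
  then show ?thesis using that F by blast
qed

text \<open>Hence almost type I is preserved by null-set preserving continuous changes of variables
  and continuous additive maps of the values.\<close>

lemma almost_typeI_comp_null_preserving:
  fixes g :: "'x::topological_space \<Rightarrow> 'c::topological_ab_group_add"
    and \<phi> :: "'c \<Rightarrow> 'd::topological_ab_group_add" and P :: "'w::topological_space \<Rightarrow> 'x"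
  assumes "almost_typeI X \<mu> g" "continuous_on A P" "P \<in> A \<rightarrow> X"
    and "\<And>N. N \<in> null_sets \<mu> \<Longrightarrow> A \<inter> P -` N \<in> null_sets \<nu>"
    and "continuous_on UNIV \<phi>" "Modules.additive \<phi>"
  shows "almost_typeI A \<nu> (\<lambda>x. \<phi> (g (P x)))"
proof -
  obtain F where F: "\<And>n. typeI X \<mu> (F n)" "locally_uniform_limit X F g"
    using assms(1) unfolding almost_typeI_def by blast
  show ?thesis unfolding almost_typeI_def
  proof (intro exI conjI allI)
    show "typeI A \<nu> (\<lambda>x. \<phi> (F n (P x)))" for n by (rule typeI_comp_null_preserving[OF F(1) assms(2-4)])
    show "locally_uniform_limit A (\<lambda>n x. \<phi> (F n (P x))) (\<lambda>x. \<phi> (g (P x)))"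
      by (rule locally_uniform_limit_comp[OF F(2) assms(2,3,5,6)])
  qed
qed

section \<open>Semi-algebraic sets and type II\<close>

text \<open>Semi-algebraic sets are stable under polynomial preimages and finite unions.\<close>

lemma semialgebraic_vimage:
  assumes "S \<in> semialgebraic" "polynomial_function P"
  shows "P -` S \<in> semialgebraic"
  using assms(1)
proof induction
  case (zero p)
  have "P -` {x. p x = 0} = {x. (p \<circ> P) x = 0}" by auto
  then show ?case using semialgebraic.zero real_polynomial_function_compose[OF assms(2) zero] by metis
next
  case (pos p)
  have "P -` {x. p x > 0} = {x. (p \<circ> P) x > 0}" by auto
  then show ?case using semialgebraic.pos real_polynomial_function_compose[OF assms(2) pos] by metis
next
  case (compl S)
  then show ?case by (metis semialgebraic.compl vimage_Compl)
next
  case (union S T)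
  then show ?case by (metis semialgebraic.union vimage_Un)
qed

lemma semialgebraic_empty: "{} \<in> semialgebraic"
  using semialgebraic.pos[OF real_polynomial_function.intros(2)[of 0]] by simp

lemma semialgebraic_UN:
  assumes "finite I" "\<And>i. i \<in> I \<Longrightarrow> S i \<in> semialgebraic"
  shows "(\<Union>i\<in>I. S i) \<in> semialgebraic"
  using assms by (induction I rule: finite_induct) (auto intro: semialgebraic_empty semialgebraic.union)

text \<open>A level set of \<open>\<phi> \<circ> g \<circ> P\<close> near a point is a finite union of pullbacks of level sets
  of \<open>g\<close>, since \<open>g\<close> takes finitely many values nearby; hence type II is preserved.\<close>

lemma typeII_comp:
  fixes g :: "'y::euclidean_space \<Rightarrow> 'c" and P :: "'x::real_normed_vector \<Rightarrow> 'y"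
  assumes "typeII X g" "polynomial_function P" "P \<in> A \<rightarrow> X"
  shows "typeII A (\<lambda>x. \<phi> (g (P x)))"
  unfolding typeII_def
proof (intro conjI ballI)
  have P: "continuous_on A P" "P \<in> A \<rightarrow> X"
    using continuous_on_polymonial_function[OF assms(2)] assms(3) by auto
  show "locally_finite_valued A (\<lambda>x. \<phi> (g (P x)))"
    using assms(1) locally_finite_valued_comp[OF _ P] unfolding typeII_def by blast
  fix x assume x: "x \<in> A"
  then have Px: "P x \<in> X" using assms(3) by blast
  obtain U1 where U1: "openin (top_of_set X) U1" "P x \<in> U1" "finite (g ` U1)"
    using assms(1) Px unfolding typeII_def locally_finite_valued_def by blast
  obtain U2 S where U2: "openin (top_of_set X) U2" "P x \<in> U2"
      and S: "\<And>b. S b \<in> semialgebraic" "\<And>b. {y\<in>U2. g y = b} = S b \<inter> U2"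
    using assms(1) Px unfolding typeII_def by metis
  define U where "U = A \<inter> P -` (U1 \<inter> U2)"
  have "openin (top_of_set A) U"
    unfolding U_def by (rule continuous_openin_preimage[OF P openin_Int[OF U1(1) U2(1)]])
  moreover have "x \<in> U" using x U1(2) U2(2) unfolding U_def by blast
  moreover have "\<exists>T\<in>semialgebraic. {y\<in>U. \<phi> (g (P y)) = a} = T \<inter> U" for a
  proof
    define B where "B = {b\<in>g ` U1. \<phi> b = a}"
    show "(\<Union>b\<in>B. P -` S b) \<in> semialgebraic"
      using U1(3) unfolding B_def by (intro semialgebraic_UN semialgebraic_vimage[OF S(1) assms(2)]) simp
    show "{y\<in>U. \<phi> (g (P y)) = a} = (\<Union>b\<in>B. P -` S b) \<inter> U"
    proof (intro equalityI subsetI)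
      fix y assume y: "y \<in> {y\<in>U. \<phi> (g (P y)) = a}"
      then have "P y \<in> U1" "P y \<in> U2" unfolding U_def by auto
      then show "y \<in> (\<Union>b\<in>B. P -` S b) \<inter> U" using y S(2)[of "g (P y)"] unfolding B_def by blast
    next
      fix y assume y: "y \<in> (\<Union>b\<in>B. P -` S b) \<inter> U"
      then obtain b where b: "b \<in> B" "P y \<in> S b" by blast
      have "P y \<in> U2" using y unfolding U_def by blast
      then have "g (P y) = b" using b(2) S(2)[of b] by blast
      then show "y \<in> {y\<in>U. \<phi> (g (P y)) = a}" using y b(1) unfolding B_def by blast
    qed
  qed
  ultimately show "\<exists>U. openin (top_of_set A) U \<and> x \<in> U \<and>
        (\<forall>a. \<exists>S\<in>semialgebraic. {y\<in>U. \<phi> (g (P y)) = a} = S \<inter> U)"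
    by blast
qed

text \<open>Hence almost type II is preserved by polynomial changes of variables.\<close>

lemma almost_typeII_comp:
  fixes g :: "'y::euclidean_space \<Rightarrow> 'c::topological_ab_group_add" and P :: "'x::real_normed_vector \<Rightarrow> 'y"
  assumes "almost_typeII X g" "polynomial_function P" "P \<in> A \<rightarrow> X"
  shows "almost_typeII A (\<lambda>x. g (P x))"
proof -
  obtain F where F: "\<And>n. typeII X (F n)" "locally_uniform_limit X F g"
    using assms(1) unfolding almost_typeII_def by blast
  show ?thesis unfolding almost_typeII_def
  proof (intro exI conjI allI)
    show "typeII A (\<lambda>x. F n (P x))" for n
      using typeII_comp[OF F(1) assms(2,3), where \<phi>=id] by simp
    show "locally_uniform_limit A (\<lambda>n x. F n (P x)) (\<lambda>x. g (P x))"
      using locally_uniform_limit_comp[OF F(2) continuous_on_polymonial_function[OF assms(2)] assms(3),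
          where \<phi>=id]
      by (simp add: Modules.additive_def)
  qed
qed

text \<open>Maps \<open>x \<mapsto> (L x, c)\<close> with \<open>L\<close> linear (slices, translated slices) are polynomial.\<close>

lemma polynomial_function_pair_const:
  assumes "bounded_linear L"
  shows "polynomial_function (\<lambda>x. (L x, c))"
proof -
  have "polynomial_function (\<lambda>x. (L x, 0) + (0, c))"
    by (rule polynomial_function_add[OF polynomial_function_bounded_linear[OF
          bounded_linear_Pair[OF assms bounded_linear_zero]] polynomial_function_const])
  then show ?thesis by simp
qed

text \<open>Hence every slice of an almost type-II function is almost type II.\<close>

lemma slice_almost_typeII:
  fixes f :: "'x::euclidean_space \<times> 'y::euclidean_space \<Rightarrow> 'c::topological_ab_group_add"
  assumes "almost_typeII (A \<times> B) f" "h \<in> B"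
  shows "almost_typeII A (\<lambda>x. f (x, h))"
  by (rule almost_typeII_comp[OF assms(1) polynomial_function_pair_const[OF bounded_linear_ident]])
    (use assms(2) in auto)

section \<open>Diagonal translation on G^n\<close>

text \<open>The diagonal left action of \<open>G\<close> on \<open>G^n\<close>.\<close>

definition translate :: "('g \<Rightarrow> 'g \<Rightarrow> 'g) \<Rightarrow> 'g \<Rightarrow> 'g ^ 'n::finite \<Rightarrow> 'g ^ 'n" where
  "translate mul k x = (\<chi> i. mul k (x $ i))"

text \<open>For matrix groups translations are linear, so the type-II theory applies to them.\<close>

lemma bounded_linear_translate_matrix:
  "bounded_linear (translate (**) (k :: real^'k::finite^'k) :: (real^'k^'k)^'n::finite \<Rightarrow> _)"
proof -
  have "linear (translate (**) k :: (real^'k^'k)^'n \<Rightarrow> _)"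
  proof (rule linearI)
    fix x y :: "(real^'k^'k)^'n" and c :: real
    show "translate (**) k (x + y) = translate (**) k x + translate (**) k y"
      by (simp add: translate_def vec_eq_iff matrix_add_ldistrib)
    have "k ** (c *\<^sub>R z) = c *\<^sub>R (k ** z)" for z :: "real^'k^'k"
      by (simp add: matrix_scalar_ac scalar_matrix_assoc)
    then show "translate (**) k (c *\<^sub>R x) = c *\<^sub>R translate (**) k x"
      by (simp add: translate_def vec_eq_iff)
  qed
  then show ?thesis by (simp add: linear_conv_bounded_linear)
qed

text \<open>Context: a locally compact second countable group, given by its carrier.\<close>

locale lcsc =
  fixes G :: "'g::topological_space set" and mul :: "'g \<Rightarrow> 'g \<Rightarrow> 'g" and iv :: "'g \<Rightarrow> 'g" and e :: 'g
  assumes lcsc_group: "lcsc_group G mul iv e"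
begin

lemma mul_closed: "x \<in> G \<Longrightarrow> y \<in> G \<Longrightarrow> mul x y \<in> G"
  and iv_closed: "x \<in> G \<Longrightarrow> iv x \<in> G"
  and unit_closed: "e \<in> G"
  and assoc: "x \<in> G \<Longrightarrow> y \<in> G \<Longrightarrow> z \<in> G \<Longrightarrow> mul (mul x y) z = mul x (mul y z)"
  and left_unit: "x \<in> G \<Longrightarrow> mul e x = x"
  and right_unit: "x \<in> G \<Longrightarrow> mul x e = x"
  and left_inv: "x \<in> G \<Longrightarrow> mul (iv x) x = e"
  and right_inv: "x \<in> G \<Longrightarrow> mul x (iv x) = e"
  and continuous_mul: "continuous_on (G \<times> G) (\<lambda>(x, y). mul x y)"
  and continuous_iv: "continuous_on G iv"
  and locally_compact: "locally_compact_space (top_of_set G)"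
  and Hausdorff: "Hausdorff_space (top_of_set G)"
  and second_countable: "second_countable (top_of_set G)"
  using lcsc_group unfolding lcsc_group_def by auto

text \<open>Basic group calculus inside the carrier.\<close>

lemma cancel_left: "k \<in> G \<Longrightarrow> x \<in> G \<Longrightarrow> mul (iv k) (mul k x) = x"
  by (metis assoc iv_closed left_unit left_inv)

lemma cancel_left_inv: "k \<in> G \<Longrightarrow> x \<in> G \<Longrightarrow> mul k (mul (iv k) x) = x"
  by (metis assoc iv_closed left_unit right_inv)

text \<open>Products of continuous \<open>G\<close>-valued maps are continuous.\<close>

lemma continuous_on_mul:
  assumes "continuous_on S a" "continuous_on S b" "a \<in> S \<rightarrow> G" "b \<in> S \<rightarrow> G"
  shows "continuous_on S (\<lambda>z. mul (a z) (b z))"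
  using continuous_on_compose2[OF continuous_mul continuous_on_Pair[OF assms(1,2)]] assms(3,4)
  by auto

text \<open>Elementary properties of the diagonal translation.\<close>

lemma gpow_iff: "x \<in> gpow G \<longleftrightarrow> (\<forall>i. x $ i \<in> G)"
  by (simp add: gpow_def)

lemma translate_closed: "k \<in> G \<Longrightarrow> x \<in> gpow G \<Longrightarrow> translate mul k x \<in> (gpow G :: ('g ^ 'n::finite) set)"
  by (simp add: translate_def gpow_iff mul_closed)

lemma translate_cancel:
  "k \<in> G \<Longrightarrow> x \<in> gpow G \<Longrightarrow> translate mul k (translate mul (iv k) x) = (x :: 'g ^ 'n::finite)"
  by (simp add: translate_def gpow_iff cancel_left_inv vec_eq_iff)

lemma translate_maps: "k \<in> G \<Longrightarrow> translate mul k \<in> gpow G \<rightarrow> (gpow G :: ('g ^ 'n::finite) set)"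
  by (simp add: translate_closed)

lemma inverse_unique: "a \<in> G \<Longrightarrow> b \<in> G \<Longrightarrow> mul a b = e \<Longrightarrow> iv a = b"
  by (metis assoc iv_closed left_unit left_inv right_unit)

lemma iv_mul_iv: "h \<in> G \<Longrightarrow> c \<in> G \<Longrightarrow> iv (mul h (iv c)) = mul c (iv h)"
  by (rule inverse_unique) (auto simp: mul_closed iv_closed assoc cancel_left right_inv)

text \<open>Translation is jointly continuous in the group element and the point of \<open>G^n\<close>.\<close>

lemma continuous_on_translate:
  assumes "continuous_on S a" "continuous_on S x" "a \<in> S \<rightarrow> G" "x \<in> S \<rightarrow> gpow G"
  shows "continuous_on S (\<lambda>z. translate mul (a z) (x z) :: 'g ^ 'n::finite)"
  unfolding translate_def
proof (intro continuous_on_vec_lambda continuous_on_mul assms(1,3))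
  fix i :: 'n
  show "continuous_on S (\<lambda>z. x z $ i)" by (intro continuous_on_component assms(2))
  show "(\<lambda>z. x z $ i) \<in> S \<rightarrow> G" using assms(4) by (auto simp: gpow_iff Pi_iff)
qed

lemma continuous_on_translate_const:
  "k \<in> G \<Longrightarrow> continuous_on (gpow G) (translate mul k :: 'g ^ 'n::finite \<Rightarrow> _)"
  using continuous_on_translate[of "gpow G" "\<lambda>_. k" "\<lambda>x. x"] by (auto intro: continuous_on_const continuous_on_id)

text \<open>Shifting slices from points \<open>c\<close> of a compact set to \<open>h\<close> only involves the arguments
  \<open>(translate (c h\<inverse>) x, c)\<close> and the group elements \<open>h c\<inverse>\<close>; both range over compact sets.\<close>

lemma compact_shifted_arguments:
  assumes C: "compact C" "C \<subseteq> G" and K: "compact K" "K \<subseteq> gpow G" and h: "h \<in> G"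
  defines "\<Phi> \<equiv> \<lambda>z. (translate mul (mul (fst z) (iv h)) (snd z) :: 'g ^ 'n::finite, fst z)"
  shows "compact (\<Phi> ` (C \<times> K))" "\<Phi> ` (C \<times> K) \<subseteq> gpow G \<times> G"
proof -
  have shift_closed: "mul a (iv h) \<in> G" if "a \<in> C" for a
    using C(2) h that by (blast intro: mul_closed iv_closed)
  have "continuous_on (C \<times> K) (\<lambda>z. mul (fst z) (iv h))"
    by (rule continuous_on_mul) (use C(2) h in \<open>auto intro: continuous_intros iv_closed\<close>)
  then have "continuous_on (C \<times> K) (\<lambda>z. translate mul (mul (fst z) (iv h)) (snd z) :: 'g ^ 'n)"
    by (rule continuous_on_translate) (use K shift_closed in \<open>auto intro: continuous_intros\<close>)
  then have "continuous_on (C \<times> K) \<Phi>"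
    unfolding \<Phi>_def by (intro continuous_on_Pair continuous_on_fst continuous_on_id)
  then show "compact (\<Phi> ` (C \<times> K))" using C K by (intro compact_continuous_image compact_Times) auto
  show "\<Phi> ` (C \<times> K) \<subseteq> gpow G \<times> G"
  proof
    fix q assume "q \<in> \<Phi> ` (C \<times> K)"
    then obtain a x where "a \<in> C" "x \<in> K" "q = \<Phi> (a, x)" by blast
    then show "q \<in> gpow G \<times> G"
      using C(2) K translate_closed[OF shift_closed] by (auto simp: \<Phi>_def)
  qed
qed

lemma compact_shift_elements:
  assumes C: "compact C" "C \<subseteq> G" and h: "h \<in> G"
  shows "compact ((\<lambda>c. mul h (iv c)) ` C)" "(\<lambda>c. mul h (iv c)) ` C \<subseteq> G"
proof -
  have "continuous_on C (\<lambda>c. mul h (iv c))"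
    by (rule continuous_on_mul[of C "\<lambda>_. h" iv])
      (use C h in \<open>auto intro: continuous_on_subset[OF continuous_iv] iv_closed\<close>)
  then show "compact ((\<lambda>c. mul h (iv c)) ` C)" using C(1) by (rule compact_continuous_image)
  show "(\<lambda>c. mul h (iv c)) ` C \<subseteq> G" using C(2) h by (auto intro: mul_closed iv_closed)
qed

end

section \<open>Haar measure\<close>

text \<open>Context: in addition a left Haar measure \<open>M\<close> on \<open>G\<close>.\<close>

locale lcsc_haar = lcsc +
  fixes M :: "'g::topological_space measure"
  assumes left_haar: "left_haar G mul M"
begin

lemma space_M: "space M = G" and sets_M: "sets M = sets (restrict_space borel G)"
  and left_invariant: "\<And>g S. g \<in> G \<Longrightarrow> S \<in> sets M \<Longrightarrow> emeasure M (mul g ` S) = emeasure M S"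
  and compact_finite: "\<And>K. compact K \<Longrightarrow> K \<subseteq> G \<Longrightarrow> emeasure M K < \<infinity>"
  and open_positive: "\<And>U. openin (top_of_set G) U \<Longrightarrow> U \<noteq> {} \<Longrightarrow> emeasure M U > 0"
  using left_haar unfolding left_haar_def by auto

text \<open>Open and closed subsets of \<open>G\<close> are measurable.\<close>

lemma openin_sets: "openin (top_of_set G) V \<Longrightarrow> V \<in> sets M"
  unfolding openin_open sets_M sets_restrict_space by auto

lemma closedin_sets: "closedin (top_of_set G) V \<Longrightarrow> V \<in> sets M"
  unfolding closedin_closed sets_M sets_restrict_space by auto

text \<open>An almost-everywhere property holds somewhere in every nonempty open set.\<close>

lemma AE_somewhere:
  assumes "AE h in M. Q h" "openin (top_of_set G) W" "W \<noteq> {}"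
  shows "\<exists>h\<in>W. Q h"
proof (rule ccontr)
  assume "\<not> (\<exists>h\<in>W. Q h)"
  then have "AE h in M. h \<notin> W" using assms(1) by (auto elim: eventually_mono)
  moreover have "{x\<in>space M. \<not> x \<notin> W} = W"
    using openin_imp_subset[OF assms(2)] space_M by auto
  ultimately have "emeasure M W = 0" using AE_iff_measurable[OF openin_sets[OF assms(2)]] by simp
  then show False using open_positive[OF assms(2,3)] by simp
qed

text \<open>Relatively compact basic open sets give a countable cover by sets of finite measure.\<close>

lemma sigma_finite: "sigma_finite_measure M"
proof
  obtain B where B: "countable B" "\<forall>V\<in>B. openin (top_of_set G) V"
      "\<forall>U x. openin (top_of_set G) U \<and> x \<in> U \<longrightarrow> (\<exists>V\<in>B. x \<in> V \<and> V \<subseteq> U)"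
    using second_countable unfolding second_countable_def by blast
  define A where "A = {V\<in>B. \<exists>K. compactin (top_of_set G) K \<and> V \<subseteq> K}"
  have "space M \<subseteq> \<Union>A"
  proof
    fix x assume "x \<in> space M"
    then obtain U K where UK: "openin (top_of_set G) U" "compactin (top_of_set G) K" "x \<in> U" "U \<subseteq> K"
      using locally_compact unfolding locally_compact_space_def space_M by auto
    then obtain V where "V \<in> B" "x \<in> V" "V \<subseteq> U" using B(3) by blast
    then show "x \<in> \<Union>A" using UK unfolding A_def by blast
  qed
  moreover have "emeasure M a \<noteq> \<infinity>" if "a \<in> A" for a
  proof -
    obtain K where K: "compactin (top_of_set G) K" "a \<subseteq> K"
      using \<open>a \<in> A\<close> unfolding A_def by blast
    have "K \<in> sets M" by (rule closedin_sets[OF compactin_imp_closedin[OF Hausdorff K(1)]])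
    moreover have "compact K" "K \<subseteq> G" using K(1) by (auto simp: compactin_subtopology)
    ultimately have "emeasure M a \<le> emeasure M K" "emeasure M K < \<infinity>"
      using K(2) compact_finite by (auto intro: emeasure_mono)
    then show ?thesis by (simp add: top.not_eq_extremum)
  qed
  moreover have "A \<subseteq> sets M" "\<Union>A \<subseteq> space M"
    using B(2) openin_sets openin_imp_subset unfolding A_def space_M by blast+
  moreover have "countable A" using B(1) unfolding A_def by simp
  ultimately show "\<exists>A::'g set set. countable A \<and> A \<subseteq> sets M \<and> \<Union>A = space M \<and> (\<forall>a\<in>A. emeasure M a \<noteq> \<infinity>)"
    by (intro exI[of _ A] conjI subset_antisym) auto
qed

text \<open>Left translations are measurable (they are continuous).\<close>

lemma mul_measurable: "k \<in> G \<Longrightarrow> mul k \<in> measurable M M"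
proof -
  assume k: "k \<in> G"
  have "continuous_on G (mul k)"
    using continuous_on_mul[of G "\<lambda>_. k" "\<lambda>x. x"] k by auto
  then have "mul k \<in> measurable (restrict_space borel G) (restrict_space borel G)"
    by (intro measurable_restrict_space2 borel_measurable_continuous_on_restrict)
      (use mul_closed[OF k] in \<open>auto simp: space_restrict_space\<close>)
  then show ?thesis using measurable_cong_sets[OF sets_M sets_M] by simp
qed

text \<open>Left invariance, phrased as invariance of \<open>M\<close> under push-forward by left translation.\<close>

lemma distr_mul: "k \<in> G \<Longrightarrow> distr M M (mul k) = M"
proof (rule measure_eqI)
  assume k: "k \<in> G"
  show "sets (distr M M (mul k)) = sets M" by simp
  fix A assume "A \<in> sets (distr M M (mul k))"
  then have A: "A \<in> sets M" by simp
  then have sub: "A \<subseteq> G" using sets.sets_into_space space_M by blast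
  have "mul k -` A \<inter> space M = mul (iv k) ` A"
  proof
    show "mul k -` A \<inter> space M \<subseteq> mul (iv k) ` A"
      using cancel_left[OF k] mul_closed[OF k] by (auto simp: space_M image_iff) metis
    show "mul (iv k) ` A \<subseteq> mul k -` A \<inter> space M"
      using cancel_left_inv[OF k] mul_closed[OF iv_closed[OF k]] sub by (auto simp: space_M)
  qed
  then show "emeasure (distr M M (mul k)) A = emeasure M A"
    using emeasure_distr[OF mul_measurable[OF k] A] left_invariant[OF iv_closed[OF k] A] by simp
qed

text \<open>The product measure on \<open>G^n\<close> and its invariance under diagonal translation.\<close>

abbreviation PM :: "('n::finite \<Rightarrow> 'g) measure" where
  "PM \<equiv> PiM UNIV (\<lambda>_. M)"

lemma space_vec_measure: "space (vec_measure M :: ('g ^ 'n::finite) measure) = gpow G"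
proof -
  have "vec_lambda ` (\<Pi>\<^sub>E i\<in>(UNIV::'n set). G) = gpow G"
  proof
    show "vec_lambda ` (\<Pi>\<^sub>E i\<in>(UNIV::'n set). G) \<subseteq> gpow G" by (auto simp: gpow_def)
    show "gpow G \<subseteq> vec_lambda ` (\<Pi>\<^sub>E i\<in>(UNIV::'n set). G)"
    proof
      fix y :: "'g ^ 'n" assume "y \<in> gpow G"
      then have "vec_nth y \<in> (\<Pi>\<^sub>E i\<in>(UNIV::'n set). G)" by (auto simp: gpow_def)
      then show "y \<in> vec_lambda ` (\<Pi>\<^sub>E i\<in>(UNIV::'n set). G)" by (metis image_eqI vec_nth_inverse)
    qed
  qed
  then show ?thesis unfolding vec_measure_def space_embed_measure space_PiM space_M .
qed

text \<open>The measure on \<open>G^n\<close> is sigma-finite, so Fubini applies to \<open>G^n \<times> G\<close>.\<close>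

lemma inj_vec_lambda: "inj vec_lambda"
  by (auto intro!: inj_onI simp: vec_lambda_inject)

lemma product_sigma_finite: "product_sigma_finite (\<lambda>_::'n. M)"
  unfolding product_sigma_finite_def using sigma_finite by simp

lemma sigma_finite_vec_measure: "sigma_finite_measure (vec_measure M :: ('g ^ 'n::finite) measure)"
  unfolding vec_measure_def
  by (rule sigma_finite_embed_measure[OF product_sigma_finite.sigma_finite[OF product_sigma_finite]
        inj_vec_lambda]) simp

lemma componentwise_measurable:
  assumes "k \<in> G"
  shows "(\<lambda>x i. mul k (x i)) \<in> measurable (PM :: ('n::finite \<Rightarrow> 'g) measure) PM"
proof -
  have "(\<lambda>x. \<lambda>i\<in>UNIV. mul k (x i)) \<in> measurable (PM :: ('n \<Rightarrow> 'g) measure) PM"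
  proof (intro measurable_restrict)
    fix i :: 'n
    show "(\<lambda>x. mul k (x i)) \<in> measurable (PM :: ('n \<Rightarrow> 'g) measure) M"
      using measurable_compose[OF measurable_component_singleton[of i UNIV "\<lambda>_. M"]
          mul_measurable[OF assms]] by simp
  qed
  then show ?thesis by (simp add: restrict_def)
qed

lemma distr_componentwise:
  assumes k: "k \<in> G"
  shows "distr (PM :: ('n::finite \<Rightarrow> 'g) measure) PM (\<lambda>x i. mul k (x i)) = PM"
proof (rule product_sigma_finite.PiM_eqI[OF product_sigma_finite])
  fix A :: "'n \<Rightarrow> 'g set" assume A: "\<And>i. i \<in> UNIV \<Longrightarrow> A i \<in> sets M"
  have box: "(\<Pi>\<^sub>E i\<in>UNIV. A i) \<in> sets (PM :: ('n \<Rightarrow> 'g) measure)"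
    using A by (intro sets_PiM_I_finite) auto
  have A': "\<And>i. mul k -` A i \<inter> space M \<in> sets M"
    using A measurable_sets[OF mul_measurable[OF k]] by blast
  have "(\<lambda>x i. mul k (x i)) -` (\<Pi>\<^sub>E i\<in>UNIV. A i) \<inter> space (PM :: ('n \<Rightarrow> 'g) measure)
      = (\<Pi>\<^sub>E i\<in>UNIV. mul k -` A i \<inter> space M)"
    by (auto simp: space_PiM PiE_def Pi_def)
  then have "emeasure (distr PM PM (\<lambda>x i. mul k (x i))) (\<Pi>\<^sub>E i\<in>UNIV. A i)
      = emeasure (PM :: ('n \<Rightarrow> 'g) measure) (\<Pi>\<^sub>E i\<in>UNIV. mul k -` A i \<inter> space M)"
    using emeasure_distr[OF componentwise_measurable[OF k] box] by simp
  also have "\<dots> = (\<Prod>i\<in>UNIV. emeasure M (mul k -` A i \<inter> space M))"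
    using A' by (intro product_sigma_finite.emeasure_PiM[OF product_sigma_finite]) auto
  also have "\<dots> = (\<Prod>i\<in>UNIV. emeasure M (A i))"
    using emeasure_distr[OF mul_measurable[OF k] A] distr_mul[OF k] by simp
  finally show "emeasure (distr PM PM (\<lambda>x i. mul k (x i))) (\<Pi>\<^sub>E i\<in>UNIV. A i)
      = (\<Prod>i\<in>UNIV. emeasure M (A i))" .
qed simp_all

lemma translate_measurable:
  assumes "k \<in> G"
  shows "translate mul k \<in> measurable (vec_measure M :: ('g ^ 'n::finite) measure) (vec_measure M)"
  unfolding vec_measure_def
proof (rule measurable_embed_measure1)
  have eq: "(\<lambda>x. translate mul k (vec_lambda x)) = (\<lambda>x. vec_lambda ((\<lambda>x i. mul k (x i)) x))"
    by (auto simp: translate_def)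
  show "(\<lambda>x. translate mul k (vec_lambda x))
      \<in> measurable (PM :: ('n \<Rightarrow> 'g) measure) (embed_measure PM vec_lambda)"
    unfolding eq by (rule measurable_compose[OF componentwise_measurable[OF assms]
        measurable_embed_measure2[OF inj_vec_lambda]])
qed

lemma distr_translate:
  assumes k: "k \<in> G"
  shows "distr (vec_measure M) (vec_measure M) (translate mul k) = (vec_measure M :: ('g ^ 'n::finite) measure)"
proof -
  let ?V = "vec_measure M :: ('g ^ 'n) measure"
  have V: "?V = distr PM ?V vec_lambda"
    unfolding vec_measure_def by (rule embed_measure_eq_distr[OF inj_vec_lambda])
  have vl: "vec_lambda \<in> measurable PM ?V"
    unfolding vec_measure_def by (rule measurable_embed_measure2[OF inj_vec_lambda])
  have "distr ?V ?V (translate mul k) = distr (distr PM ?V vec_lambda) ?V (translate mul k)"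
    using V by simp
  also have "\<dots> = distr PM ?V (translate mul k \<circ> vec_lambda)"
    by (rule distr_distr[OF translate_measurable[OF k] vl])
  also have "translate mul k \<circ> vec_lambda = vec_lambda \<circ> (\<lambda>x i. mul k (x i))"
    by (auto simp: translate_def)
  also have "distr PM ?V (vec_lambda \<circ> (\<lambda>x i. mul k (x i)))
      = distr (distr PM PM (\<lambda>x i. mul k (x i))) ?V vec_lambda"
    by (rule distr_distr[OF vl componentwise_measurable[OF k], symmetric])
  also have "\<dots> = ?V" using V by (simp add: distr_componentwise[OF k])
  finally show ?thesis .
qed

text \<open>Translations of \<open>G^n\<close> pull null sets back to null sets.\<close>

lemma translate_null:
  assumes k: "k \<in> G" and N: "N \<in> null_sets (vec_measure M :: ('g ^ 'n::finite) measure)"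
  shows "gpow G \<inter> translate mul k -` N \<in> null_sets (vec_measure M :: ('g ^ 'n::finite) measure)"
proof -
  let ?V = "vec_measure M :: ('g ^ 'n) measure"
  have Ns: "N \<in> sets ?V" using N by auto
  have "emeasure ?V (translate mul k -` N \<inter> space ?V) = emeasure (distr ?V ?V (translate mul k)) N"
    using emeasure_distr[OF translate_measurable[OF k] Ns] by simp
  also have "\<dots> = 0" using null_setsD1[OF N] by (simp add: distr_translate[OF k])
  finally have "translate mul k -` N \<inter> space ?V \<in> null_sets ?V"
    using measurable_sets[OF translate_measurable[OF k] Ns] by auto
  moreover have "gpow G \<inter> translate mul k -` N = translate mul k -` N \<inter> space ?V"
    using space_vec_measure by auto
  ultimately show ?thesis by simp
qed

text \<open>Fubini: a null set of \<open>G^n \<times> G\<close> has null slices at almost every \<open>h\<close>.\<close>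

lemma AE_null_slices:
  assumes N: "N \<in> null_sets ((vec_measure M :: ('g ^ 'n::finite) measure) \<Otimes>\<^sub>M M)"
  shows "AE h in M. {x\<in>gpow G. (x, h) \<in> N} \<in> null_sets (vec_measure M :: ('g ^ 'n::finite) measure)"
proof -
  let ?V = "vec_measure M :: ('g ^ 'n) measure"
  interpret pair_sigma_finite ?V M
    unfolding pair_sigma_finite_def using sigma_finite_vec_measure sigma_finite by simp
  have "AE x in ?V. AE y in M. (x, y) \<notin> N" by (rule AE_pair[OF AE_not_in[OF N]])
  moreover have "{z\<in>space (?V \<Otimes>\<^sub>M M). (fst z, snd z) \<notin> N} = space (?V \<Otimes>\<^sub>M M) - N" by auto
  ultimately have "AE y in M. AE x in ?V. (x, y) \<notin> N"
    using AE_commute[of "\<lambda>x y. (x, y) \<notin> N"] N by auto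
  then show ?thesis
  proof (rule eventually_mono)
    fix y assume ae: "AE x in ?V. (x, y) \<notin> N"
    have S: "(\<lambda>x. (x, y)) -` N \<inter> space ?V \<in> sets ?V"
      using sets_Pair2[of N ?V M y] N by auto
    moreover have "{x\<in>gpow G. (x, y) \<in> N} = (\<lambda>x. (x, y)) -` N \<inter> space ?V"
      using space_vec_measure by auto
    ultimately show "{x\<in>gpow G. (x, y) \<in> N} \<in> null_sets ?V"
      using ae AE_iff_measurable[OF S, of "\<lambda>x. (x, y) \<notin> N"] by auto
  qed
qed

text \<open>Consequently, for almost every \<open>h\<close> all slices of a sequence of type-I functions are
  type I: apply Fubini to each of the countably many exceptional null sets.\<close>

lemma AE_slices_typeI:
  fixes F :: "nat \<Rightarrow> ('g ^ 'n::finite) \<times> 'g \<Rightarrow> 'c"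
  assumes "\<And>n. typeI (gpow G \<times> G) (vec_measure M \<Otimes>\<^sub>M M) (F n)"
  shows "AE h in M. h \<in> G \<and> (\<forall>n. typeI (gpow G) (vec_measure M) (\<lambda>x. F n (x, h)))"
proof -
  let ?X = "gpow G \<times> G :: (('g ^ 'n) \<times> 'g) set"
  obtain U where U: "\<And>n. openin (top_of_set ?X) (U n)" "\<And>n. ?X - U n \<in> null_sets (vec_measure M \<Otimes>\<^sub>M M)"
      "\<And>n. locally_constant_on ?X (U n) (F n)"
    using assms unfolding typeI_def by metis
  have "AE h in M. \<forall>n. {x\<in>gpow G. (x, h) \<in> ?X - U n} \<in> null_sets (vec_measure M)"
    using AE_null_slices[OF U(2)] by (simp add: AE_all_countable)
  with AE_space have "AE h in M. h \<in> space M \<and>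
      (\<forall>n. {x\<in>gpow G. (x, h) \<in> ?X - U n} \<in> null_sets (vec_measure M))"
    by (rule AE_conjI)
  then show ?thesis
  proof (rule eventually_mono, intro conjI allI)
    fix h n assume "h \<in> space M \<and> (\<forall>n. {x\<in>gpow G. (x, h) \<in> ?X - U n} \<in> null_sets (vec_measure M))"
    then have h: "h \<in> G" and null: "\<forall>n. {x\<in>gpow G. (x, h) \<in> ?X - U n} \<in> null_sets (vec_measure M)"
      using space_M by auto
    then show "h \<in> G" by simp
    have "gpow G \<inter> (\<lambda>x. (x, h)) -` (?X - U n) = {x\<in>gpow G. (x, h) \<in> ?X - U n}" by auto
    then have "gpow G \<inter> (\<lambda>x. (x, h)) -` (?X - U n) \<in> null_sets (vec_measure M)"
      using null by simp
    moreover have "locally_finite_valued ?X (F n)" using assms unfolding typeI_def by blast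
    ultimately show "typeI (gpow G) (vec_measure M) (\<lambda>x. F n (x, h))"
      using h by (intro typeI_comp[OF _ U(1) U(3), where \<phi>="\<lambda>y. y"]) (auto intro: continuous_intros)
  qed
qed

text \<open>Good slicing points: given type-I functions \<open>F n\<close> and neighbourhoods \<open>V n\<close> of the
  identity of \<open>G^n \<times> G\<close>, there are points \<open>c n\<close> in one compact set whose diagonal lies
  in \<open>V n\<close> and at which all slices of all \<open>F m\<close> are type I: a.e. point is good, and the
  preimages of the \<open>V n\<close> under the diagonal are nonempty open, hence not null.\<close>

lemma good_slicing_points:
  fixes F :: "nat \<Rightarrow> ('g ^ 'n::finite) \<times> 'g \<Rightarrow> 'c" and V :: "nat \<Rightarrow> (('g ^ 'n) \<times> 'g) set"
  assumes F: "\<And>n. typeI (gpow G \<times> G) (vec_measure M \<Otimes>\<^sub>M M) (F n)"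
    and V: "\<And>n. openin (top_of_set (gpow G \<times> G)) (V n)" "\<And>n. ((\<chi> i. e), e) \<in> V n"
  obtains C c where "compact C" "C \<subseteq> G" "\<And>n. c n \<in> C" "\<And>n. ((\<chi> i. c n), c n) \<in> V n"
    "\<And>n m. typeI (gpow G) (vec_measure M) (\<lambda>x. F m (x, c n))"
proof -
  define diag where "diag c = ((\<chi> i. c) :: 'g ^ 'n, c)" for c
  have "e \<in> topspace (top_of_set G)" using unit_closed by simp
  then obtain U C where U: "openin (top_of_set G) U" "e \<in> U" "U \<subseteq> C"
      and "compactin (top_of_set G) C"
    using locally_compact unfolding locally_compact_space_def by blast
  then have C: "compact C" "C \<subseteq> G" by (auto simp: compactin_subtopology)
  have diag_open: "openin (top_of_set G) (G \<inter> diag -` V n)" for n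
    unfolding diag_def by (rule continuous_openin_preimage[OF _ _ V(1)])
      (auto intro!: continuous_on_Pair continuous_on_vec_lambda continuous_on_id simp: gpow_iff)
  have "\<forall>n. \<exists>c. c \<in> U \<inter> (G \<inter> diag -` V n) \<and> c \<in> G \<and> (\<forall>m. typeI (gpow G) (vec_measure M) (\<lambda>x. F m (x, c)))"
  proof
    fix n
    have "e \<in> U \<inter> (G \<inter> diag -` V n)" using U(2) V(2) unit_closed by (auto simp: diag_def)
    then have "\<exists>c \<in> U \<inter> (G \<inter> diag -` V n). c \<in> G \<and> (\<forall>m. typeI (gpow G) (vec_measure M) (\<lambda>x. F m (x, c)))"
      by (intro AE_somewhere[OF AE_slices_typeI[OF F] openin_Int[OF U(1) diag_open]]) auto
    then show "\<exists>c. c \<in> U \<inter> (G \<inter> diag -` V n) \<and> c \<in> G \<and>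
        (\<forall>m. typeI (gpow G) (vec_measure M) (\<lambda>x. F m (x, c)))" by blast
  qed
  then have "\<exists>c. \<forall>n. c n \<in> U \<inter> (G \<inter> diag -` V n) \<and> c n \<in> G \<and>
      (\<forall>m. typeI (gpow G) (vec_measure M) (\<lambda>x. F m (x, c n)))"
    by (rule choice)
  then obtain c where "\<forall>n. c n \<in> U \<inter> (G \<inter> diag -` V n) \<and> c n \<in> G \<and>
      (\<forall>m. typeI (gpow G) (vec_measure M) (\<lambda>x. F m (x, c n)))"
    by blast
  then show ?thesis using that[OF C] U(3) unfolding diag_def by blast
qed

end

section \<open>G-modules and shifted slices\<close>

text \<open>Context: in addition a Polish \<open>G\<close>-module, i.e. a continuous action by additive maps.\<close>

locale lcsc_module = lcsc +
  fixes act :: "'g::topological_space \<Rightarrow> 'a::{polish_space, topological_ab_group_add} \<Rightarrow> 'a"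
  assumes polish_G_module: "polish_G_module G mul e act"
begin

text \<open>Each group element acts by a continuous additive map.\<close>

lemma act_additive: "k \<in> G \<Longrightarrow> Modules.additive (act k)"
  using polish_G_module unfolding polish_G_module_def Modules.additive_def by auto

lemma continuous_act: "continuous_on (G \<times> UNIV) (\<lambda>(g, a). act g a)"
  using polish_G_module unfolding polish_G_module_def by auto

lemma continuous_act_fixed:
  assumes "k \<in> G" shows "continuous_on UNIV (act k)"
proof -
  have "continuous_on UNIV ((\<lambda>(g, a). act g a) \<circ> (\<lambda>a. (k, a)))"
    by (rule continuous_on_compose[OF _ continuous_on_subset[OF continuous_act]])
      (use assms in \<open>auto intro!: continuous_intros\<close>)
  then show ?thesis by (simp add: o_def)
qed

text \<open>The action is uniformly continuous at \<open>0\<close> over a compact set of group elements.\<close>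

lemma act_uniform_at_zero:
  assumes C: "compact C" "C \<subseteq> G" and V: "open V" "0 \<in> V"
  shows "\<exists>X0. open X0 \<and> 0 \<in> X0 \<and> (\<forall>k\<in>C. \<forall>w\<in>X0. act k w \<in> V)"
proof -
  obtain Op where Op: "open Op" "(G \<times> UNIV) \<inter> (\<lambda>(g, a). act g a) -` V = (G \<times> UNIV) \<inter> Op"
    using continuous_openin_preimage_gen[OF continuous_act V(1)] unfolding openin_open by blast
  have "{0::'a} \<times> C \<subseteq> prod.swap -` Op"
  proof
    fix z assume "z \<in> {0::'a} \<times> C"
    then obtain k where z: "z = (0, k)" "k \<in> C" by blast
    then have "act k 0 = 0" using C(2) additive.zero[OF act_additive] by blast
    then have "(k, 0) \<in> (G \<times> UNIV) \<inter> (\<lambda>(g, a). act g a) -` V" using C(2) z(2) V(2) by auto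
    then show "z \<in> prod.swap -` Op" using Op(2) z(1) by auto
  qed
  then obtain X0 where X0: "0 \<in> X0" "open X0" "X0 \<times> C \<subseteq> prod.swap -` Op"
    using Elementary_Topology.tube_lemma[OF C(1) open_vimage[OF Op(1) continuous_on_swap]] by blast
  have "act k w \<in> V" if "k \<in> C" "w \<in> X0" for k w
  proof -
    have "(k, w) \<in> (G \<times> UNIV) \<inter> Op" using X0(3) C(2) that by auto
    then have "(k, w) \<in> (G \<times> UNIV) \<inter> (\<lambda>(g, a). act g a) -` V" by (simp only: Op(2))
    then show ?thesis by simp
  qed
  then show ?thesis using X0 by blast
qed

text \<open>The slice of \<open>g\<close> at \<open>c\<close>, moved to \<open>h\<close> by the translation \<open>k = h c\<inverse>\<close> of arguments and values.\<close>

definition shift_slice :: "(('g ^ 'n::finite) \<times> 'g \<Rightarrow> 'a) \<Rightarrow> 'g \<Rightarrow> 'g \<Rightarrow> 'g ^ 'n \<Rightarrow> 'a" where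
  "shift_slice g h c x = act (mul h (iv c)) (g (translate mul (mul c (iv h)) x, c))"

text \<open>For an equivariant function shifting the slice at \<open>c\<close> gives exactly the slice at \<open>h\<close>.\<close>

lemma shift_slice_equivariant:
  assumes "equivariant G mul act f" "h \<in> G" "c \<in> G" "x \<in> gpow G"
  shows "shift_slice f h c x = f (x, h)"
proof -
  let ?k = "mul h (iv c)" and ?y = "translate mul (mul c (iv h)) x"
  have k: "?k \<in> G" using assms(2,3) by (simp add: mul_closed iv_closed)
  have y: "?y \<in> gpow G" using assms(2-4) by (simp add: mul_closed iv_closed translate_closed)
  have "translate mul ?k ?y = x" using translate_cancel[OF k assms(4)] by (simp add: iv_mul_iv assms(2,3))
  moreover have "mul ?k c = h" using assms(2,3) by (simp add: assoc iv_closed left_inv right_unit)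
  moreover have "f (translate mul ?k ?y, mul ?k c) = act ?k (f (?y, c))"
    using assms(1) k y assms(3) unfolding equivariant_def translate_def by blast
  ultimately show ?thesis unfolding shift_slice_def by simp
qed

text \<open>If \<open>g\<close> is constant near \<open>(c,\<dots>,c,c)\<close>, its shifted slice is constant near \<open>(h,\<dots>,h)\<close>.\<close>

lemma shift_slice_locally_constant:
  assumes V: "openin (top_of_set (gpow G \<times> G)) V" "\<forall>y\<in>V. g y = g z" "((\<chi> i. c), c) \<in> V"
    and h: "h \<in> G" and c: "c \<in> G"
  shows "\<exists>W. openin (top_of_set (gpow G)) W \<and> (\<chi> i. h) \<in> W \<and>
          (\<forall>y\<in>W. shift_slice g h c y = shift_slice g h c (\<chi> i. h :: 'g ^ 'n::finite))"
proof -
  have k: "mul c (iv h) \<in> G" using h c by (simp add: mul_closed iv_closed)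
  define P where "P x = (translate mul (mul c (iv h)) x, c)" for x :: "'g ^ 'n"
  have "continuous_on (gpow G) P"
    unfolding P_def by (intro continuous_on_Pair continuous_on_translate_const[OF k] continuous_on_const)
  moreover have "P \<in> gpow G \<rightarrow> gpow G \<times> G" using translate_maps[OF k] c by (auto simp: P_def)
  moreover have "locally_constant_on (gpow G \<times> G) V g"
    unfolding locally_constant_on_def
  proof
    fix x assume "x \<in> V"
    then show "\<exists>W. openin (top_of_set (gpow G \<times> G)) W \<and> x \<in> W \<and> W \<subseteq> V \<and> (\<forall>y\<in>W. g y = g x)"
    proof (intro exI[of _ V] conjI)
      show "\<forall>y\<in>V. g y = g x" using V(2) \<open>x \<in> V\<close> by metis
    qed (use V(1) \<open>x \<in> V\<close> in auto)
  qed
  ultimately have "locally_constant_on (gpow G) (gpow G \<inter> P -` V) (\<lambda>x. act (mul h (iv c)) (g (P x)))"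
    by (intro locally_constant_on_comp)
  moreover have "(\<lambda>x. act (mul h (iv c)) (g (P x))) = shift_slice g h c"
    by (simp add: fun_eq_iff P_def shift_slice_def)
  ultimately have lc: "locally_constant_on (gpow G) (gpow G \<inter> P -` V) (shift_slice g h c)" by simp
  have "P (\<chi> i. h) = ((\<chi> i. c), c)"
    using h c by (simp add: P_def translate_def assoc iv_closed left_inv right_unit)
  then have "(\<chi> i. h) \<in> gpow G \<inter> P -` V" using V(3) h by (simp add: gpow_iff)
  with lc have "\<exists>W. openin (top_of_set (gpow G)) W \<and> (\<chi> i. h) \<in> W \<and> W \<subseteq> gpow G \<inter> P -` V \<and>
      (\<forall>y\<in>W. shift_slice g h c y = shift_slice g h c (\<chi> i. h))"
    unfolding locally_constant_on_def by (rule bspec)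
  then show ?thesis by blast
qed

text \<open>Shifted slices of approximants taken at points of a compact set converge to the slice
  of the limit: all arguments involved range over the compact image of \<open>C \<times> K\<close>.\<close>

lemma shift_slice_converges:
  fixes f :: "('g ^ 'n::finite) \<times> 'g \<Rightarrow> 'a"
  assumes F: "locally_uniform_limit (gpow G \<times> G) F f" and eqv: "equivariant G mul act f"
    and h: "h \<in> G" and C: "compact C" "C \<subseteq> G" and c: "\<And>n. c n \<in> C"
  shows "locally_uniform_limit (gpow G) (\<lambda>n. shift_slice (F n) h (c n)) (\<lambda>x. f (x, h))"
  unfolding locally_uniform_limit_def unif_conv_on_def
proof (intro allI impI)
  fix K :: "('g ^ 'n) set" and V :: "'a set"
  assume K: "compact K \<and> K \<subseteq> gpow G" and V: "open V \<and> 0 \<in> V"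
  have K': "compact K" "K \<subseteq> gpow G" using K by auto
  define \<Phi> where "\<Phi> = (\<lambda>z. (translate mul (mul (fst z) (iv h)) (snd z) :: 'g ^ 'n, fst z))"
  have Q: "compact (\<Phi> ` (C \<times> K))" "\<Phi> ` (C \<times> K) \<subseteq> gpow G \<times> G"
    unfolding \<Phi>_def by (fact compact_shifted_arguments[OF C K' h])+
  have "\<exists>X0. open X0 \<and> 0 \<in> X0 \<and> (\<forall>k\<in>(\<lambda>c. mul h (iv c)) ` C. \<forall>w\<in>X0. act k w \<in> V)"
    using compact_shift_elements[OF C h] V by (intro act_uniform_at_zero) auto
  then obtain X0 where X0: "open X0" "0 \<in> X0" "\<forall>k\<in>(\<lambda>c. mul h (iv c)) ` C. \<forall>w\<in>X0. act k w \<in> V"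
    by blast
  have "\<forall>\<^sub>F n in sequentially. \<forall>q\<in>\<Phi> ` (C \<times> K). F n q - f q \<in> X0"
    using F Q X0(1,2) unfolding locally_uniform_limit_def unif_conv_on_def by blast
  then show "\<forall>\<^sub>F n in sequentially. \<forall>x\<in>K. shift_slice (F n) h (c n) x - f (x, h) \<in> V"
  proof (rule eventually_mono, intro ballI)
    fix n x assume n: "\<forall>q\<in>\<Phi> ` (C \<times> K). F n q - f q \<in> X0" and x: "x \<in> K"
    have cn: "c n \<in> G" using c C(2) by blast
    have k: "mul h (iv (c n)) \<in> G" using cn h by (simp add: mul_closed iv_closed)
    have "shift_slice (F n) h (c n) x - f (x, h) = shift_slice (F n) h (c n) x - shift_slice f h (c n) x"
      using shift_slice_equivariant[OF eqv h cn] x K by auto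
    also have "\<dots> = act (mul h (iv (c n))) (F n (\<Phi> (c n, x)) - f (\<Phi> (c n, x)))"
      by (simp add: shift_slice_def \<Phi>_def additive.diff[OF act_additive[OF k]])
    also have "\<dots> \<in> V"
    proof -
      have "F n (\<Phi> (c n, x)) - f (\<Phi> (c n, x)) \<in> X0" using n c x by blast
      moreover have "mul h (iv (c n)) \<in> (\<lambda>c. mul h (iv c)) ` C" using c by blast
      ultimately show ?thesis using X0(3) by blast
    qed
    finally show "shift_slice (F n) h (c n) x - f (x, h) \<in> V" .
  qed
qed

end

section \<open>Slices of almost type-I functions\<close>

text \<open>Context: an lcsc group with left Haar measure and a Polish \<open>G\<close>-module.\<close>

locale lcsc_haar_module = lcsc_haar G mul iv e M + lcsc_module G mul iv e act
  for G :: "'g::topological_space set" and mul iv e M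
    and act :: "'g \<Rightarrow> 'a::{polish_space, topological_ab_group_add} \<Rightarrow> 'a"
begin

text \<open>A type-I slice stays type I when shifted, since translations preserve null sets.\<close>

lemma typeI_shift_slice:
  assumes "typeI (gpow G) (vec_measure M) (\<lambda>x. g (x, c))" "h \<in> G" "c \<in> G"
  shows "typeI (gpow G) (vec_measure M) (shift_slice g h c :: 'g ^ 'n::finite \<Rightarrow> 'a)"
proof -
  have k: "mul c (iv h) \<in> G" using assms(2,3) by (simp add: mul_closed iv_closed)
  show ?thesis unfolding shift_slice_def
    by (rule typeI_comp_null_preserving[OF assms(1) continuous_on_translate_const[OF k]
          translate_maps[OF k] translate_null[OF k]])
qed

text \<open>The a.e. statement: slice the approximants at a point where all their slices are type I.\<close>

lemma AE_slice_almost_typeI: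
  fixes f :: "('g ^ 'n::finite) \<times> 'g \<Rightarrow> 'a"
  assumes "almost_typeI (gpow G \<times> G) (vec_measure M \<Otimes>\<^sub>M M) f"
  shows "AE h in M. almost_typeI (gpow G) (vec_measure M) (\<lambda>x. f (x, h))"
proof -
  obtain F where F: "\<And>n. typeI (gpow G \<times> G) (vec_measure M \<Otimes>\<^sub>M M) (F n)"
      "locally_uniform_limit (gpow G \<times> G) F f"
    using assms unfolding almost_typeI_def by blast
  show ?thesis using AE_slices_typeI[OF F(1)]
  proof (rule eventually_mono)
    fix h assume h: "h \<in> G \<and> (\<forall>n. typeI (gpow G) (vec_measure M) (\<lambda>x. F n (x, h)))"
    have "locally_uniform_limit (gpow G) (\<lambda>n x. F n (x, h)) (\<lambda>x. f (x, h))"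
      by (rule locally_uniform_limit_comp[OF F(2), where \<phi>="\<lambda>y. y"])
        (use h in \<open>auto intro: continuous_intros simp: Modules.additive_def\<close>)
    then show "almost_typeI (gpow G) (vec_measure M) (\<lambda>x. f (x, h))"
      unfolding almost_typeI_def using h by (intro exI[of _ "\<lambda>n x. F n (x, h)"] conjI) auto
  qed
qed

text \<open>Equivariance upgrades "almost every slice" to "every slice": shift a good slice.\<close>

lemma slice_almost_typeI:
  fixes f :: "('g ^ 'n::finite) \<times> 'g \<Rightarrow> 'a"
  assumes "almost_typeI (gpow G \<times> G) (vec_measure M \<Otimes>\<^sub>M M) f" "equivariant G mul act f" "h \<in> G"
  shows "almost_typeI (gpow G) (vec_measure M) (\<lambda>x. f (x, h))"
proof -
  have "openin (top_of_set G) G" "G \<noteq> {}" using unit_closed by auto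
  then obtain c where c: "c \<in> G" "almost_typeI (gpow G) (vec_measure M) (\<lambda>x. f (x, c))"
    using AE_somewhere[OF AE_slice_almost_typeI[OF assms(1)]] by blast
  have k: "mul c (iv h) \<in> G" "mul h (iv c) \<in> G" using assms(3) c(1) by (simp_all add: mul_closed iv_closed)
  have "almost_typeI (gpow G) (vec_measure M) (shift_slice f h c)"
    unfolding shift_slice_def
    by (rule almost_typeI_comp_null_preserving[OF c(2) continuous_on_translate_const[OF k(1)]
          translate_maps[OF k(1)] translate_null[OF k(1)] continuous_act_fixed[OF k(2)]
          act_additive[OF k(2)]])
  then show ?thesis
    by (rule almost_typeI_cong) (rule shift_slice_equivariant[OF assms(2,3) c(1)])
qed

text \<open>Regularity: approximants \<open>F n\<close> constant near the identity are sliced at good points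
  \<open>c n\<close> chosen in a compact neighbourhood of \<open>e\<close>, inside the set where \<open>F n\<close> is constant.\<close>

lemma slice_regular_typeI:
  fixes f :: "('g ^ 'n::finite) \<times> 'g \<Rightarrow> 'a"
  assumes eqv: "equivariant G mul act f"
    and reg: "regular_typeI (gpow G \<times> G) (vec_measure M \<Otimes>\<^sub>M M) f ((\<chi> i. e), e)"
    and h: "h \<in> G"
  shows "regular_typeI (gpow G) (vec_measure M) (\<lambda>x. f (x, h)) (\<chi> i. h)"
proof -
  let ?X = "gpow G \<times> G :: (('g ^ 'n) \<times> 'g) set" and ?E = "((\<chi> i. e) :: 'g ^ 'n, e)"
  obtain F V where F: "\<And>n. typeI ?X (vec_measure M \<Otimes>\<^sub>M M) (F n)" "locally_uniform_limit ?X F f"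
      and V: "\<And>n. openin (top_of_set ?X) (V n)" "\<And>n. ?E \<in> V n" "\<And>n. \<forall>y\<in>V n. F n y = F n ?E"
    using reg unfolding regular_typeI_def by (elim conjE regular_approximants) blast
  obtain C c where C: "compact C" "C \<subseteq> G" and c: "\<And>n. c n \<in> C" "\<And>n. ((\<chi> i. c n), c n) \<in> V n"
      "\<And>n m. typeI (gpow G) (vec_measure M) (\<lambda>x. F m (x, c n))"
    by (rule good_slicing_points[where F=F and V=V]) (rule F(1) V(1) V(2) | blast)+
  have cG: "c n \<in> G" for n using c(1) C(2) by blast
  have typeI_n: "typeI (gpow G) (vec_measure M) (shift_slice (F n) h (c n))" for n
    by (rule typeI_shift_slice[OF c(3) h cG])
  have const_n: "\<exists>W. openin (top_of_set (gpow G)) W \<and> (\<chi> i. h) \<in> W \<and>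
      (\<forall>y\<in>W. shift_slice (F n) h (c n) y = shift_slice (F n) h (c n) (\<chi> i. h))" for n
    by (rule shift_slice_locally_constant[OF V(1,3) c(2) h cG])
  have limit: "locally_uniform_limit (gpow G) (\<lambda>n. shift_slice (F n) h (c n)) (\<lambda>x. f (x, h))"
    by (rule shift_slice_converges[OF F(2) eqv h C c(1)])
  have "almost_typeI ?X (vec_measure M \<Otimes>\<^sub>M M) f" using reg unfolding regular_typeI_def by blast
  then have almost: "almost_typeI (gpow G) (vec_measure M) (\<lambda>x. f (x, h))"
    by (rule slice_almost_typeI[OF _ eqv h])
  show ?thesis unfolding regular_typeI_def
    by (intro conjI allI exI[of _ "\<lambda>n. shift_slice (F n) h (c n)"]; rule typeI_n const_n limit almost)
qed

end

text \<open>The statements of the theorem for almost type-I functions on a general lcsc group.\<close>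

lemma slices_typeI:
  fixes f :: "('g::topological_space ^ 'n::finite) \<times> 'g \<Rightarrow> 'a::{polish_space, topological_ab_group_add}"
  assumes "lcsc_group G mul iv e" "left_haar G mul M" "polish_G_module G mul e act"
    and "almost_typeI (gpow G \<times> G) (vec_measure M \<Otimes>\<^sub>M M) f"
  shows "(AE h in M. almost_typeI (gpow G) (vec_measure M) (\<lambda>x. f (x, h))) \<and>
        (equivariant G mul act f \<longrightarrow>
           (\<forall>h\<in>G. almost_typeI (gpow G) (vec_measure M) (\<lambda>x. f (x, h))) \<and>
           (regular_typeI (gpow G \<times> G) (vec_measure M \<Otimes>\<^sub>M M) f ((\<chi> i. e), e) \<longrightarrow>
              (\<forall>h\<in>G. regular_typeI (gpow G) (vec_measure M) (\<lambda>x. f (x, h)) (\<chi> i. h))))"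
proof -
  interpret lcsc_haar_module G mul iv e M act
    using assms(1-3) by unfold_locales
  show ?thesis
  proof (intro conjI impI)
    show "AE h in M. almost_typeI (gpow G) (vec_measure M) (\<lambda>x. f (x, h))"
      by (rule AE_slice_almost_typeI[OF assms(4)])
    assume eqv: "equivariant G mul act f"
    then show "\<forall>h\<in>G. almost_typeI (gpow G) (vec_measure M) (\<lambda>x. f (x, h))"
      using slice_almost_typeI[OF assms(4)] by blast
    assume "regular_typeI (gpow G \<times> G) (vec_measure M \<Otimes>\<^sub>M M) f ((\<chi> i. e), e)"
    then show "\<forall>h\<in>G. regular_typeI (gpow G) (vec_measure M) (\<lambda>x. f (x, h)) (\<chi> i. h)"
      using slice_regular_typeI[OF eqv] by blast
  qed
qed

section \<open>Slices of almost type-II functions on matrix groups\<close>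

text \<open>Regularity of type-II slices needs no measure theory: the slices of the approximants
  at the identity are type II and constant near the identity, and shifting them to \<open>h\<close> is
  a polynomial change of variables.\<close>

lemma slice_regular_typeII:
  fixes G :: "(real ^ 'k::finite ^ 'k) set"
    and act :: "real ^ 'k ^ 'k \<Rightarrow> 'a::{polish_space, topological_ab_group_add} \<Rightarrow> 'a"
    and f :: "((real ^ 'k ^ 'k) ^ 'n::finite) \<times> (real ^ 'k ^ 'k) \<Rightarrow> 'a"
  assumes "lcsc_group G (**) matrix_inv (mat 1)" "polish_G_module G (**) (mat 1) act"
    and eqv: "equivariant G (**) act f"
    and reg: "regular_typeII (gpow G \<times> G) f ((\<chi> i. mat 1), mat 1)" and h: "h \<in> G"
  shows "regular_typeII (gpow G) (\<lambda>x. f (x, h)) (\<chi> i. h)"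
proof -
  interpret lcsc_module G "(**)" matrix_inv "mat 1" act
    using assms(1,2) by unfold_locales
  let ?X = "gpow G \<times> G :: (((real ^ 'k ^ 'k) ^ 'n) \<times> (real ^ 'k ^ 'k)) set"
  let ?E = "((\<chi> i. mat 1) :: (real ^ 'k ^ 'k) ^ 'n, mat 1 :: real ^ 'k ^ 'k)"
  obtain F V where F: "\<And>n. typeII ?X (F n)" "locally_uniform_limit ?X F f"
      and V: "\<And>n. openin (top_of_set ?X) (V n)" "\<And>n. ?E \<in> V n" "\<And>n. \<forall>y\<in>V n. F n y = F n ?E"
    using reg unfolding regular_typeII_def by (elim conjE regular_approximants) blast
  have typeII_n: "typeII (gpow G) (shift_slice (F n) h (mat 1))" for n
    unfolding shift_slice_def
    using h unit_closed
    by (intro typeII_comp[OF F(1) polynomial_function_pair_const[OF bounded_linear_translate_matrix]])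
      (auto intro!: translate_closed mul_closed iv_closed)
  have const_n: "\<exists>W. openin (top_of_set (gpow G)) W \<and> (\<chi> i. h) \<in> W \<and>
      (\<forall>y\<in>W. shift_slice (F n) h (mat 1) y = shift_slice (F n) h (mat 1) (\<chi> i. h))" for n
    by (rule shift_slice_locally_constant[OF V(1,3) V(2) h unit_closed])
  have limit: "locally_uniform_limit (gpow G) (\<lambda>n. shift_slice (F n) h (mat 1)) (\<lambda>x. f (x, h))"
    using shift_slice_converges[OF F(2) eqv h, of "{mat 1}"] unit_closed by auto
  have "almost_typeII ?X f" using reg unfolding regular_typeII_def by blast
  then have almost: "almost_typeII (gpow G) (\<lambda>x. f (x, h))" by (rule slice_almost_typeII[OF _ h])
  show ?thesis unfolding regular_typeII_def
    by (intro conjI allI exI[of _ "\<lambda>n. shift_slice (F n) h (mat 1)"];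
        rule typeII_n const_n limit almost)
qed

text \<open>The statements of the theorem for almost type-II functions on a matrix group.\<close>

lemma slices_typeII:
  fixes G :: "(real ^ 'k::finite ^ 'k) set"
    and act :: "real ^ 'k ^ 'k \<Rightarrow> 'a::{polish_space, topological_ab_group_add} \<Rightarrow> 'a"
    and f :: "((real ^ 'k ^ 'k) ^ 'n::finite) \<times> (real ^ 'k ^ 'k) \<Rightarrow> 'a"
  assumes "lcsc_group G (**) matrix_inv (mat 1)" "left_haar G (**) M"
    and "polish_G_module G (**) (mat 1) act" and "almost_typeII (gpow G \<times> G) f"
  shows "(AE h in M. almost_typeII (gpow G) (\<lambda>x. f (x, h))) \<and>
        (equivariant G (**) act f \<longrightarrow>
           (\<forall>h\<in>G. almost_typeII (gpow G) (\<lambda>x. f (x, h))) \<and>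
           (regular_typeII (gpow G \<times> G) f ((\<chi> i. mat 1), mat 1) \<longrightarrow>
              (\<forall>h\<in>G. regular_typeII (gpow G) (\<lambda>x. f (x, h)) (\<chi> i. h))))"
proof (intro conjI impI)
  have "space M = G" using assms(2) unfolding left_haar_def by blast
  then show "AE h in M. almost_typeII (gpow G) (\<lambda>x. f (x, h))"
    using slice_almost_typeII[OF assms(4)] by (intro AE_I2) auto
  show "\<forall>h\<in>G. almost_typeII (gpow G) (\<lambda>x. f (x, h))"
    using slice_almost_typeII[OF assms(4)] by blast
  assume "equivariant G (**) act f" "regular_typeII (gpow G \<times> G) f ((\<chi> i. mat 1), mat 1)"
  then show "\<forall>h\<in>G. regular_typeII (gpow G) (\<lambda>x. f (x, h)) (\<chi> i. h)"
    using slice_regular_typeII[OF assms(1,3)] by blast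
qed

text \<open>The theorem is the conjunction of the type-I and the type-II statements.\<close>

theorem lemma3p2:
  shows
  "(\<forall>(G::'g::topological_space set) mul iv e M (act::'g \<Rightarrow> 'a::{polish_space, topological_ab_group_add} \<Rightarrow> 'a)
        (f::('g ^ 'n::finite) \<times> 'g \<Rightarrow> 'a).
      lcsc_group G mul iv e \<and> left_haar G mul M \<and> polish_G_module G mul e act \<and>
      almost_typeI (gpow G \<times> G) (vec_measure M \<Otimes>\<^sub>M M) f \<longrightarrow>
        (AE h in M. almost_typeI (gpow G) (vec_measure M) (\<lambda>x. f (x, h))) \<and>
        (equivariant G mul act f \<longrightarrow>
           (\<forall>h\<in>G. almost_typeI (gpow G) (vec_measure M) (\<lambda>x. f (x, h))) \<and>
           (regular_typeI (gpow G \<times> G) (vec_measure M \<Otimes>\<^sub>M M) f ((\<chi> i. e), e) \<longrightarrow>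
              (\<forall>h\<in>G. regular_typeI (gpow G) (vec_measure M) (\<lambda>x. f (x, h)) (\<chi> i. h)))))
   \<and>
   (\<forall>(G::(real ^ 'k::finite ^ 'k) set) M (act::real ^ 'k ^ 'k \<Rightarrow> 'a \<Rightarrow> 'a)
        (f::((real ^ 'k ^ 'k) ^ 'n) \<times> (real ^ 'k ^ 'k) \<Rightarrow> 'a).
      algebraic_subgroup G \<and> lcsc_group G (**) matrix_inv (mat 1) \<and> left_haar G (**) M \<and>
      polish_G_module G (**) (mat 1) act \<and> almost_typeII (gpow G \<times> G) f \<longrightarrow>
        (AE h in M. almost_typeII (gpow G) (\<lambda>x. f (x, h))) \<and>
        (equivariant G (**) act f \<longrightarrow>
           (\<forall>h\<in>G. almost_typeII (gpow G) (\<lambda>x. f (x, h))) \<and>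
           (regular_typeII (gpow G \<times> G) f ((\<chi> i. mat 1), mat 1) \<longrightarrow>
              (\<forall>h\<in>G. regular_typeII (gpow G) (\<lambda>x. f (x, h)) (\<chi> i. h)))))"
  by (rule conjI; intro allI impI; elim conjE; (rule slices_typeI slices_typeII; assumption))

end
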